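(* Let $l>1$, let $X\subset\mathbb{R}^l$ be a nonempty compact set, let $f:\mathbb{R}^l\to\mathbb{R}$ be continuous, and let $g_0,\dots,g_n:X\to\mathbb{R}$ and $h_0,\dots,h_m:X\to\mathbb{R}$ be given functions. Write $\mathbf{G}(\mathbf{x})=(g_0(\mathbf{x}),\dots,g_n(\mathbf{x}))^T$ and $\mathbf{H}(\mathbf{x})=(h_0(\mathbf{x}),\dots,h_m(\mathbf{x}))^T$. Then the function $$\Phi(\mathbf{A},\mathbf{B})=\sup_{\mathbf{x}\in X}\left|f(\mathbf{x})-\frac{\mathbf{A}^T\mathbf{G}(\mathbf{x})}{\mathbf{B}^T\mathbf{H}(\mathbf{x})}\right|$$ of the variables $(\mathbf{A},\mathbf{B})$ is quasiconvex on the set $$D=\{(\mathbf{A},\mathbf{B})\in\mathbb{R}^{n+1}\times\mathbb{R}^{m+1}:\ \mathbf{B}^T\mathbf{H}(\mathbf{x})>0\ \text{ for all } \mathbf{x}\in X\}.$$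
   Context: The functions $g_i,h_j$ are the basis functions of a multivariate generalised rational approximation (a ratio of linear forms); they are not required to be monomials. The decision variables are the coefficient vectors $\mathbf{A}=(a_0,\dots,a_n)^T\in\mathbb{R}^{n+1}$ and $\mathbf{B}=(b_0,\dots,b_m)^T\in\mathbb{R}^{m+1}$. The function $\Phi$ takes values in $[0,+\infty]$. A function $\Phi:D\to[0,+\infty]$ is quasiconvex on $D$ if $D$ is convex and, for every $\alpha\in\mathbb{R}$, the sublevel set $\{(\mathbf{A},\mathbf{B})\in D:\Phi(\mathbf{A},\mathbf{B})\le\alpha\}$ is convex. *)

theory Defs
  imports "HOL-Analysis.Analysis"
begin

(* An index type of cardinality n + 1 plays the role of {0..n}, so that A ranges over real^'n. *)
definition basis_vec :: "('i::finite \<Rightarrow> 'x \<Rightarrow> real) \<Rightarrow> 'x \<Rightarrow> real ^ 'i" where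
  "basis_vec g x = (\<chi> i. g i x)"

definition admissible_set ::
  "'x set \<Rightarrow> ('m::finite \<Rightarrow> 'x \<Rightarrow> real) \<Rightarrow> ((real ^ 'n) \<times> (real ^ 'm)) set" where
  "admissible_set X h = {(A, B). \<forall>x\<in>X. B \<bullet> basis_vec h x > 0}"

(* The supremum is taken in [0, \<infinity>]: it may be infinite, as the basis functions need
   not be bounded.  Outside admissible_set X h a denominator may vanish, and the value then
   carries no meaning. *)
definition max_deviation ::
  "'x set \<Rightarrow> ('x \<Rightarrow> real) \<Rightarrow> ('n::finite \<Rightarrow> 'x \<Rightarrow> real) \<Rightarrow> ('m::finite \<Rightarrow> 'x \<Rightarrow> real)
    \<Rightarrow> (real ^ 'n) \<times> (real ^ 'm) \<Rightarrow> ennreal" where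
  "max_deviation X f g h = (\<lambda>(A, B).
     SUP x\<in>X. ennreal \<bar>f x - (A \<bullet> basis_vec g x) / (B \<bullet> basis_vec h x)\<bar>)"

(* The comparison is made in ereal because ennreal \<alpha> would truncate a negative \<alpha> to 0. *)
definition quasiconvex_on :: "'a::real_vector set \<Rightarrow> ('a \<Rightarrow> ennreal) \<Rightarrow> bool" where
  "quasiconvex_on D \<phi> \<longleftrightarrow>
     convex D \<and> (\<forall>\<alpha>::real. convex {p \<in> D. enn2ereal (\<phi> p) \<le> ereal \<alpha>})"

end

theory Submission
  imports Defs
begin

text \<open>
  Where the denominator is positive, the inequality
  \<open>\<bar>f x - (A \<bullet> G x) / (B \<bullet> H x)\<bar> \<le> \<alpha>\<close> can be multiplied out, and it becomes a pair of
  inequalities that are linear in \<open>(A, B)\<close>.  The supremum is at most \<open>\<alpha>\<close> exactly if this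
  holds at every \<open>x\<close>, so that a sublevel set inside the admissible set is an intersection of
  half-spaces, hence convex.  This is the content of \<open>sublevel_set_eq_halfspaces\<close>.
  For \<open>\<alpha> < 0\<close> the sublevel set is empty.
\<close>

lemma abs_diff_quotient_le_iff:
  fixes c u v \<alpha> :: real
  assumes "v > 0"
  shows "\<bar>c - u / v\<bar> \<le> \<alpha> \<longleftrightarrow> (c - \<alpha>) * v - u \<le> 0 \<and> u - (c + \<alpha>) * v \<le> 0"
proof -
  have "\<bar>c - u / v\<bar> \<le> \<alpha> \<longleftrightarrow> c - \<alpha> \<le> u / v \<and> u / v \<le> c + \<alpha>"
    by (auto simp: abs_le_iff)
  also have "\<dots> \<longleftrightarrow> (c - \<alpha>) * v - u \<le> 0 \<and> u - (c + \<alpha>) * v \<le> 0"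
    using assms by (simp add: pos_le_divide_eq pos_divide_le_eq)
  finally show ?thesis .
qed

lemma max_deviation_le_iff:
  assumes "\<alpha> \<ge> 0"
  shows "enn2ereal (max_deviation X f g h (A, B)) \<le> ereal \<alpha> \<longleftrightarrow>
    (\<forall>x\<in>X. \<bar>f x - (A \<bullet> basis_vec g x) / (B \<bullet> basis_vec h x)\<bar> \<le> \<alpha>)"
proof -
  have "enn2ereal (max_deviation X f g h (A, B)) \<le> ereal \<alpha> \<longleftrightarrow>
      max_deviation X f g h (A, B) \<le> ennreal \<alpha>"
    using assms by (simp add: less_eq_ennreal.rep_eq enn2ereal_ennreal)
  then show ?thesis
    using assms by (simp add: max_deviation_def SUP_le_iff)
qed

lemma admissible_set_eq_halfspaces:
  "admissible_set X h = (\<Inter>x\<in>X. {p. (0, basis_vec h x) \<bullet> p > 0})"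
  by (auto simp: admissible_set_def inner_commute)

lemma convex_admissible_set: "convex (admissible_set X h)"
  unfolding admissible_set_eq_halfspaces by (intro convex_INT convex_halfspace_gt)

text \<open>
  The two normal vectors at \<open>x\<close> are the coefficients of the linear forms
  \<open>(f x - \<alpha>) * (B \<bullet> H x) - A \<bullet> G x\<close> and \<open>A \<bullet> G x - (f x + \<alpha>) * (B \<bullet> H x)\<close>, which must
  both be nonpositive: the approximation may lie neither below \<open>f x - \<alpha>\<close> nor above
  \<open>f x + \<alpha>\<close>.
\<close>

lemma sublevel_set_eq_halfspaces:
  assumes "\<alpha> \<ge> 0"
  shows "{p \<in> admissible_set X h. enn2ereal (max_deviation X f g h p) \<le> ereal \<alpha>} =
    admissible_set X h \<inter>
    (\<Inter>x\<in>X. {p. (- basis_vec g x, (f x - \<alpha>) *\<^sub>R basis_vec h x) \<bullet> p \<le> 0} \<inter>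
            {p. (basis_vec g x, - ((f x + \<alpha>) *\<^sub>R basis_vec h x)) \<bullet> p \<le> 0})"
    (is "?L = admissible_set X h \<inter> ?R")
proof -
  have "enn2ereal (max_deviation X f g h p) \<le> ereal \<alpha> \<longleftrightarrow> p \<in> ?R"
    if p: "p \<in> admissible_set X h" for p
  proof -
    obtain A B where AB: "p = (A, B)" by (cases p)
    have pos: "B \<bullet> basis_vec h x > 0" if "x \<in> X" for x
      using p that by (simp add: AB admissible_set_def)
    show ?thesis
      using pos
      by (simp add: AB max_deviation_le_iff[OF assms] abs_diff_quotient_le_iff
          inner_commute[of _ A] inner_commute[of _ B])
  qed
  then show ?thesis by blast
qed

lemma convex_sublevel_set:
  "convex {p \<in> admissible_set X h. enn2ereal (max_deviation X f g h p) \<le> ereal \<alpha>}"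
proof (cases "\<alpha> \<ge> 0")
  case True
  show ?thesis
    unfolding sublevel_set_eq_halfspaces[OF True]
    by (intro convex_Int convex_INT convex_admissible_set convex_halfspace_le)
next
  case False
  have "\<not> enn2ereal y \<le> ereal \<alpha>" for y
    using False enn2ereal_nonneg[of y] order_trans[of 0 "enn2ereal y" "ereal \<alpha>"] by auto
  then show ?thesis by simp
qed

theorem theorem1:
  fixes X :: "(real ^ 'l) set"
    and f :: "real ^ 'l \<Rightarrow> real"
    and g :: "'n::finite \<Rightarrow> real ^ 'l \<Rightarrow> real"
    and h :: "'m::finite \<Rightarrow> real ^ 'l \<Rightarrow> real"
  assumes "CARD('l) > 1"
    and "X \<noteq> {}" and "compact X"
    and "continuous_on UNIV f"
  shows "quasiconvex_on (admissible_set X h) (max_deviation X f g h)"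
  unfolding quasiconvex_on_def
  by (simp add: convex_admissible_set convex_sublevel_set)

end
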